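(* Let $d\ge2$. For $\lambda>\lambda_c$ let $\mu(\lambda)$ be the time constant of continuum percolation on a homogeneous Poisson point process of intensity $\lambda$ in $\mathbb{R}^d$. Then, as $\lambda\to\infty$, $$\mu(\lambda)-1\in O\big(\lambda^{-1/d}(\log\lambda)^{1/d}\big).$$
   Context: $|\cdot|$ is the Euclidean norm and $o$ the origin of $\mathbb{R}^d$. Let $X$ be a homogeneous Poisson point process with intensity $\lambda$ in $\mathbb{R}^d$. The critical intensity $\lambda_c$ is the infimum over all $\lambda>0$ for which $\bigcup_{i}B_{1/2}(X_i)$ (balls of radius $1/2$ centered at the points of $X$) almost surely has an unbounded connected component. For $\lambda>\lambda_c$ this union almost surely contains a unique unbounded connected component (known); $\mathcal{C}_\infty\subset X$ is the set of points of $X$ contained in it. For an integer $k\ge1$, two points $x,y\in\mathbb{R}^d$ are $k$-connectable if there exist (not necessarily distinct) $X_{i_1},\ldots,X_{i_{k-1}}\in X$ such that $|X_{i_j}-X_{i_{j+1}}|\le1$ for all $j\in\{0,\ldots,k-1\}$, where $X_{i_0}=x$ and $X_{i_k}=y$. The time constant $\mu=\mu(\lambda)\in(0,\infty)$: for $x\in\mathbb{R}^d$ let $q(x)$ be the element of $\mathcal{C}_\infty$ minimizing the distance to $x$, and let $D_n$ be the minimum integer $k\ge1$ such that $q(o)$ and $q(ne_1)$ are $k$-connectable, where $e_1=(1,0,\ldots,0)$. It is known (Yao, Chen, Guo 2011) that there is a deterministic $\mu\in(0,\infty)$ with $\lim_{n\to\infty}n^{-1}D_n=\mu$ almost surely.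 *)

theory Defs
  imports "HOL-Probability.Probability" "HOL-Library.Landau_Symbols"
begin

definition locally_finite_set :: "'a::euclidean_space set \<Rightarrow> bool" where
  "locally_finite_set S \<longleftrightarrow> (\<forall>B. bounded B \<longrightarrow> finite (S \<inter> B))"

text \<open>A homogeneous Poisson process is almost surely simple, so it is represented as a random
  locally finite set of points. The Poisson weights are written out because
  \<^const>\<open>poisson_pmf\<close> is only meaningful for positive rates, whereas Lebesgue-null
  sets \<open>B\<close> have rate \<open>0\<close>.\<close>

definition poisson_process ::
    "'w measure \<Rightarrow> real \<Rightarrow> ('w \<Rightarrow> 'a::euclidean_space set) \<Rightarrow> bool" where
  "poisson_process M lam X \<longleftrightarrow>
     prob_space M \<and>
     (\<forall>\<omega>\<in>space M. locally_finite_set (X \<omega>)) \<and>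
     (\<forall>B. B \<in> sets borel \<and> bounded B \<longrightarrow>
        (\<lambda>\<omega>. card (X \<omega> \<inter> B)) \<in> measurable M (count_space UNIV) \<and>
        (\<forall>k. measure M {\<omega> \<in> space M. card (X \<omega> \<inter> B) = k} =
             exp (- (lam * measure lborel B)) * (lam * measure lborel B) ^ k / fact k)) \<and>
     (\<forall>(I :: nat set) B. finite I \<and> disjoint_family_on B I \<and>
        (\<forall>i\<in>I. B i \<in> sets borel \<and> bounded (B i)) \<longrightarrow>
        prob_space.indep_vars M (\<lambda>_. count_space UNIV) (\<lambda>i \<omega>. card (X \<omega> \<inter> B i)) I)"

definition ball_union :: "'a::euclidean_space set \<Rightarrow> 'a set" where
  "ball_union S = (\<Union>x\<in>S. cball x (1/2))"

definition percolates :: "'a::euclidean_space set \<Rightarrow> bool" where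
  "percolates S \<longleftrightarrow> (\<exists>C\<in>components (ball_union S). \<not> bounded C)"

text \<open>Whether percolation occurs almost surely depends only on the law of the process, so it
  suffices to consider processes realised canonically as the identity map on a probability
  space whose outcomes are the point sets themselves.\<close>

definition critical_intensity :: "'a::euclidean_space itself \<Rightarrow> real" where
  "critical_intensity _ =
     Inf {lam. lam > 0 \<and>
       (\<exists>P :: 'a set measure. poisson_process P lam (\<lambda>S. S) \<and> (AE S in P. percolates S))}"

text \<open>Above the critical intensity the unbounded component is almost surely unique, so there
  \<open>infinite_cluster S\<close> consists of the points of \<open>S\<close> in that one component.\<close>

definition infinite_cluster :: "'a::euclidean_space set \<Rightarrow> 'a set" where
  "infinite_cluster S = {x \<in> S. \<exists>C\<in>components (ball_union S). \<not> bounded C \<and> x \<in> C}"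

definition nearest_infinite :: "'a::euclidean_space set \<Rightarrow> 'a \<Rightarrow> 'a" where
  "nearest_infinite S x = arg_min_on (\<lambda>y. dist x y) (infinite_cluster S)"

definition connectable :: "'a::euclidean_space set \<Rightarrow> nat \<Rightarrow> 'a \<Rightarrow> 'a \<Rightarrow> bool" where
  "connectable S k x y \<longleftrightarrow>
     (\<exists>p :: nat \<Rightarrow> 'a. p 0 = x \<and> p k = y \<and>
        (\<forall>j. 1 \<le> j \<and> j < k \<longrightarrow> p j \<in> S) \<and>
        (\<forall>j<k. dist (p j) (p (Suc j)) \<le> 1))"

text \<open>The value is \<open>\<infinity>\<close> if the two points are not connectable at all.\<close>

definition hop_distance :: "'a::euclidean_space set \<Rightarrow> 'a \<Rightarrow> 'a \<Rightarrow> enat" where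
  "hop_distance S x y = (INF k\<in>{k. 1 \<le> k \<and> connectable S k x y}. enat k)"

definition time_constant ::
    "'w measure \<Rightarrow> ('w \<Rightarrow> 'a::euclidean_space set) \<Rightarrow> 'a \<Rightarrow> real \<Rightarrow> bool" where
  "time_constant M X e \<mu> \<longleftrightarrow>
     0 < \<mu> \<and>
     (AE \<omega> in M. (\<lambda>n. ereal_of_enat (hop_distance (X \<omega>) (nearest_infinite (X \<omega>) 0)
                           (nearest_infinite (X \<omega>) (real n *\<^sub>R e))) / ereal (real n))
                 \<longlonglongrightarrow> ereal \<mu>)"

end

theory Submission
  imports Defs "HOL-Real_Asymp.Real_Asymp"
begin

text \<open>Put \<open>\<epsilon> = (ln \<lambda> / \<lambda>)\<^sup>1\<^sup>/\<^sup>d\<close>, so that a cube of side \<open>\<epsilon>\<close> is empty with probability \<open>1/\<lambda>\<close>.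
  Place such cubes in the plane of \<open>e1\<close> and a second basis vector: columns a distance
  \<open>s \<le> 1 - (d + 1) \<epsilon>\<close> apart and rows a distance \<open>\<epsilon>\<close> apart, so that points in cubes of adjacent
  columns and equal or adjacent rows are within distance 1. Oriented percolation of nonempty cubes
  with closed density \<open>1/\<lambda>\<close> survives with high probability, both forward from the cube at the
  origin and backward from the one at \<open>N s e1 = n e1\<close>. The forward path puts the origin's cube into
  the infinite cluster; glued to the backward path it yields at most \<open>N + 2\<close> hops between the cluster
  points nearest to \<open>0\<close> and \<open>n e1\<close>, where \<open>N \<approx> n / (1 - (d + 1) \<epsilon>)\<close>. As this occurs with
  probability at least 1/2 for each \<open>n\<close>, it occurs infinitely often with positive probability, which
  bounds the almost sure limit.\<close>

section \<open>Oriented percolation\<close>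

text \<open>\<open>C\<close> is the set of closed sites; every path of \<open>n\<close> steps
  \<open>(1, 0)\<close> or \<open>(1, 1)\<close> from \<open>(i, j)\<close> meets it. Recursion on
  the first step is the form in which the Peierls walk is built.\<close>

primrec blocked :: "(int \<times> int) set \<Rightarrow> nat \<Rightarrow> int \<Rightarrow> int \<Rightarrow> bool" where
  "blocked C 0 i j \<longleftrightarrow> (i, j) \<in> C"
| "blocked C (Suc n) i j \<longleftrightarrow> (i, j) \<in> C \<or> blocked C n (i + 1) j \<and> blocked C n (i + 1) (j + 1)"

lemma not_blocked_path:
  assumes "\<not> blocked C n i j"
  shows "\<exists>f :: nat \<Rightarrow> int. f 0 = j \<and> (\<forall>k<n. f (Suc k) = f k \<or> f (Suc k) = f k + 1) \<and>
    (\<forall>k\<le>n. (i + int k, f k) \<notin> C)"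
  using assms
proof (induction n arbitrary: i j)
  case 0
  then show ?case by auto
next
  case (Suc n)
  then obtain j' where open_ij: "(i, j) \<notin> C" and j': "j' = j \<or> j' = j + 1"
    and nb: "\<not> blocked C n (i + 1) j'"
    by auto
  from Suc.IH[OF nb] obtain f where f: "f 0 = j'"
    "\<forall>k<n. f (Suc k) = f k \<or> f (Suc k) = f k + 1" "\<forall>k\<le>n. (i + 1 + int k, f k) \<notin> C"
    by blast
  define g where "g = (\<lambda>k. case k of 0 \<Rightarrow> j | Suc k' \<Rightarrow> f k')"
  have "\<forall>k<Suc n. g (Suc k) = g k \<or> g (Suc k) = g k + 1"
    using f j' by (auto simp: g_def split: nat.split)
  moreover have "(i + int k, g k) \<notin> C" if "k \<le> Suc n" for k
    using that f(3) open_ij by (cases k) (auto simp: g_def add.assoc)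
  ultimately show ?case
    by (intro exI[of _ g]) (auto simp: g_def)
qed

text \<open>A Peierls argument without planar topology: if \<open>v\<close> is blocked, then there is a walk from \<open>v\<close> to
  \<open>v + (0, 1)\<close> with steps \<open>(1, 0)\<close> and \<open>(-1, -1)\<close>, and with steps \<open>(0, 1)\<close> out of closed sites only.
  After loop erasure the latter sites are distinct, and as the displacements add up to \<open>(0, 1)\<close>, \<open>h\<close> of
  them force a walk of length exactly \<open>3 h - 2\<close>.\<close>

datatype move = Up | Down | Across

primrec displacement :: "move \<Rightarrow> int \<times> int" where
  "displacement Up = (1, 0)"
| "displacement Down = (- 1, - 1)"
| "displacement Across = (0, 1)"

primrec crossed :: "int \<times> int \<Rightarrow> move list \<Rightarrow> (int \<times> int) list" where
  "crossed u [] = []"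
| "crossed u (m # w) = (if m = Across then [u] else []) @ crossed (u + displacement m) w"

abbreviation end_site :: "int \<times> int \<Rightarrow> move list \<Rightarrow> int \<times> int" where
  "end_site u w \<equiv> u + sum_list (map displacement w)"

lemma crossed_append: "crossed u (w @ w') = crossed u w @ crossed (end_site u w) w'"
  by (induction w arbitrary: u) (auto simp: add.assoc)

lemma crossed_split:
  assumes "v \<in> set (crossed u w)"
  obtains w1 w2 where "w = w1 @ Across # w2" "end_site u w1 = v"
  using assms
proof (induction w arbitrary: u thesis)
  case Nil
  then show ?case by simp
next
  case (Cons m w)
  show ?case
  proof (cases "m = Across \<and> v = u")
    case True
    then show ?thesis using Cons.prems(1)[of "[]" w] by simp
  next
    case False
    then have "v \<in> set (crossed (u + displacement m) w)"
      using Cons.prems(2) by (auto split: if_splits)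
    from Cons.IH[OF _ this] obtain w1 w2 where
      "w = w1 @ Across # w2" "end_site (u + displacement m) w1 = v" by blast
    then show ?thesis
      using Cons.prems(1)[of "m # w1" w2] by (simp add: add.assoc)
  qed
qed

text \<open>From a closed site step \<open>Across\<close>. From an open one both successors are
  blocked: after \<open>Up\<close>, their two walks concatenate and climb two rows, and
  \<open>Down\<close> returns to the original column one row above the start.\<close>

lemma blocked_walk:
  assumes "blocked C n i j"
  shows "\<exists>w. end_site (i, j) w = (i, j + 1) \<and> set (crossed (i, j) w) \<subseteq> C"
  using assms
proof (induction n arbitrary: i j)
  case 0
  then show ?case by (intro exI[of _ "[Across]"]) auto
next
  case (Suc n)
  show ?case
  proof (cases "(i, j) \<in> C")
    case True
    then show ?thesis by (intro exI[of _ "[Across]"]) auto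
  next
    case False
    then have "blocked C n (i + 1) j" "blocked C n (i + 1) (j + 1)"
      using Suc.prems by auto
    from this[THEN Suc.IH] obtain w w' where
      w: "end_site (i + 1, j) w = (i + 1, j + 1)" "set (crossed (i + 1, j) w) \<subseteq> C" and
      w': "end_site (i + 1, j + 1) w' = (i + 1, j + 1 + 1)" "set (crossed (i + 1, j + 1) w') \<subseteq> C"
      by auto
    have sums: "sum_list (map displacement w) = (0, 1)" "sum_list (map displacement w') = (0, 1)"
      using w(1) w'(1) by (auto simp: prod_eq_iff)
    show ?thesis
      using w(2) w'(2)
      by (intro exI[of _ "Up # w @ w' @ [Down]"]) (simp add: crossed_append sums)
  qed
qed

text \<open>If the first step is an \<open>Across\<close> out of \<open>u\<close> and the reduced
  tail also leaves \<open>u\<close> by \<open>Across\<close>, then starting at that later occurrence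
  drops a loop. Only sites left by \<open>Across\<close> become distinct; other sites may still
  recur.\<close>

lemma erase_loops:
  "\<exists>w'. end_site u w' = end_site u w \<and> set (crossed u w') \<subseteq> set (crossed u w) \<and>
     distinct (crossed u w')"
proof (induction w arbitrary: u)
  case Nil
  then show ?case by (intro exI[of _ "[]"]) auto
next
  case (Cons m w)
  from Cons.IH[of "u + displacement m"] obtain w' where w':
    "end_site (u + displacement m) w' = end_site (u + displacement m) w"
    "set (crossed (u + displacement m) w') \<subseteq> set (crossed (u + displacement m) w)"
    "distinct (crossed (u + displacement m) w')" by blast
  show ?case
  proof (cases "m = Across \<and> u \<in> set (crossed (u + displacement m) w')")
    case False
    then show ?thesis
      using w' by (intro exI[of _ "m # w'"]) (auto simp: add.assoc)
  next
    case True
    then obtain w1 w2 where split: "w' = w1 @ Across # w2" "end_site (u + displacement m) w1 = u"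
      using crossed_split by blast
    have "crossed (u + displacement m) w' = crossed (u + displacement m) w1 @ crossed u (Across # w2)"
      by (simp only: split(1) crossed_append split(2))
    moreover have "end_site (u + displacement m) w' = end_site u (Across # w2)"
      unfolding split(1) map_append sum_list.append add.assoc[symmetric] split(2) ..
    ultimately show ?thesis
      using w' by (intro exI[of _ "Across # w2"]) (auto simp: add.assoc)
  qed
qed

text \<open>Comparing coordinates, \<open>Up\<close> and \<open>Down\<close> occur equally often and
  \<open>Across\<close> exactly once more.\<close>

lemma length_walk_across:
  assumes "end_site u w = u + (0, 1)"
  shows "length w + 2 = 3 * length (crossed u w)"
proof -
  have "sum_list (map displacement w) =
      (int (count_list w Up) - int (count_list w Down),
       int (count_list w Across) - int (count_list w Down))"
  proof (induction w)
    case (Cons m w)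
    then show ?case by (cases m) auto
  qed (simp add: zero_prod_def)
  moreover have "length w = count_list w Up + count_list w Down + count_list w Across"
  proof (induction w)
    case (Cons m w)
    then show ?case by (cases m) auto
  qed simp
  moreover have "length (crossed u w) = count_list w Across"
    by (induction w arbitrary: u) auto
  ultimately show ?thesis
    using assms by simp
qed

text \<open>Here \<open>h\<close> is one less than the number of crossed sites, which turns the
  length \<open>3 * Suc h - 2\<close> into \<open>3 * h + 1\<close>.\<close>

lemma blocked_distinct_walk:
  assumes "blocked C n 0 0"
  obtains w h where "length w = 3 * h + 1" "distinct (crossed 0 w)"
    "length (crossed 0 w) = Suc h" "set (crossed 0 w) \<subseteq> C"
proof -
  from blocked_walk[OF assms] obtain w where "end_site (0,0) w = (0, 0) + (0, 1)"
    "set (crossed (0,0) w) \<subseteq> C" by auto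
  with erase_loops[of "(0,0)" w] obtain w' where w': "end_site (0,0) w' = (0, 0) + (0, 1)"
    "set (crossed (0,0) w') \<subseteq> C" "distinct (crossed (0,0) w')" by fastforce
  have len: "length w' + 2 = 3 * length (crossed (0,0) w')"
    by (rule length_walk_across[OF w'(1)])
  show thesis
    using that[of w' "length (crossed (0,0) w') - 1"] w' len
    by (cases "crossed (0,0) w'") (auto simp: zero_prod_def)
qed

section \<open>Void probabilities and the Peierls sum\<close>

lemma poisson_void:
  assumes P: "poisson_process M lam X" and B: "B \<in> sets borel" "bounded B"
  shows "{\<omega> \<in> space M. X \<omega> \<inter> B = {}} \<in> sets M"
    and "measure M {\<omega> \<in> space M. X \<omega> \<inter> B = {}} = exp (- (lam * measure lborel B))"
proof -
  \<comment> \<open>\<open>card\<close> is 0 on infinite sets too; local finiteness excludes that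
    case.\<close>
  have eq: "{\<omega> \<in> space M. X \<omega> \<inter> B = {}} = {\<omega> \<in> space M. card (X \<omega> \<inter> B) = 0}"
    using P B by (auto simp: poisson_process_def locally_finite_set_def)
  have meas: "(\<lambda>\<omega>. card (X \<omega> \<inter> B)) \<in> measurable M (count_space UNIV)"
    and prob: "\<forall>k. measure M {\<omega> \<in> space M. card (X \<omega> \<inter> B) = k} =
             exp (- (lam * measure lborel B)) * (lam * measure lborel B) ^ k / fact k"
    using P B unfolding poisson_process_def by blast+
  from meas show "{\<omega> \<in> space M. X \<omega> \<inter> B = {}} \<in> sets M"
    unfolding eq by measurable
  show "measure M {\<omega> \<in> space M. X \<omega> \<inter> B = {}} = exp (- (lam * measure lborel B))"
    unfolding eq using spec[OF prob, of 0] by simp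
qed

lemma finite_move_lists: "finite {w :: move list. length w = n}"
  and card_move_lists: "card {w :: move list. length w = n} = 3 ^ n"
proof -
  have UNIV: "UNIV = {Up, Down, Across}"
    using move.exhaust by auto
  have fin: "finite (UNIV :: move set)" unfolding UNIV by simp
  have card: "card (UNIV :: move set) = 3" unfolding UNIV by simp
  show "finite {w :: move list. length w = n}"
    using finite_lists_length_eq[OF fin, of n] by simp
  show "card {w :: move list. length w = n} = 3 ^ n"
    using card_lists_length_eq[OF fin, of n] card by simp
qed

text \<open>All cells of \<open>U\<close> are empty iff their union is, and volume adds over
  disjoint cells, so the void probability of the union is a product.\<close>

lemma poisson_cells_void:
  fixes cell :: "'b \<Rightarrow> 'a::euclidean_space set"
  assumes P: "poisson_process M lam X"
    and cell: "\<And>u. cell u \<in> sets borel" "\<And>u. bounded (cell u)" "disjoint_family cell"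
      "\<And>u. measure lborel (cell u) = v"
    and U: "finite U"
  shows "{\<omega> \<in> space M. \<forall>u\<in>U. X \<omega> \<inter> cell u = {}} \<in> sets M"
    and "measure M {\<omega> \<in> space M. \<forall>u\<in>U. X \<omega> \<inter> cell u = {}} = exp (- (lam * v)) ^ card U"
proof -
  have eq: "{\<omega> \<in> space M. \<forall>u\<in>U. X \<omega> \<inter> cell u = {}} =
      {\<omega> \<in> space M. X \<omega> \<inter> (\<Union>u\<in>U. cell u) = {}}"
    by auto
  have sets: "(\<Union>u\<in>U. cell u) \<in> sets borel" "bounded (\<Union>u\<in>U. cell u)"
    using cell U by (auto intro!: bounded_UN)
  have "measure lborel (\<Union>u\<in>U. cell u) = (\<Sum>u\<in>U. measure lborel (cell u))"
  proof (rule measure_finite_Union[OF U])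
    show "cell ` U \<subseteq> sets lborel" using cell(1) by auto
    show "disjoint_family_on cell U"
      using cell(3) by (auto simp: disjoint_family_on_def)
    show "emeasure lborel (cell u) \<noteq> \<infinity>" if "u \<in> U" for u
      using emeasure_bounded_finite[OF cell(2)[of u]] by simp
  qed
  then have vol: "measure lborel (\<Union>u\<in>U. cell u) = real (card U) * v"
    using cell(4) by simp
  show "{\<omega> \<in> space M. \<forall>u\<in>U. X \<omega> \<inter> cell u = {}} \<in> sets M"
    unfolding eq by (rule poisson_void(1)[OF P sets])
  show "measure M {\<omega> \<in> space M. \<forall>u\<in>U. X \<omega> \<inter> cell u = {}} = exp (- (lam * v)) ^ card U"
    unfolding eq poisson_void(2)[OF P sets] vol exp_of_nat_mult[symmetric]
    by (simp add: algebra_simps)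
qed

text \<open>At most \<open>3 ^ (3 * h + 1)\<close> walks cross \<open>Suc h\<close> distinct cells,
  and each has all these cells empty with probability \<open>q ^ Suc h\<close>. For
  \<open>q \<le> 1 / 54\<close> the ratio \<open>27 * q\<close> is at most 1/2 and the sum is below
  1/4. The walks do not refer to \<open>n\<close>, so one event serves all depths.\<close>

lemma survival_event:
  fixes cell :: "int \<times> int \<Rightarrow> 'a::euclidean_space set"
  assumes P: "poisson_process M lam X"
    and cell: "\<And>u. cell u \<in> sets borel" "\<And>u. bounded (cell u)" "disjoint_family cell"
      "\<And>u. measure lborel (cell u) = v"
    and small: "exp (- (lam * v)) \<le> 1 / 54"
  obtains E where "E \<in> sets M" "measure M E \<ge> 3 / 4"
    "\<And>\<omega> n. \<omega> \<in> E \<Longrightarrow> \<not> blocked {u. X \<omega> \<inter> cell u = {}} n 0 0"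
proof -
  interpret prob_space M using P by (simp add: poisson_process_def)
  define q where "q = exp (- (lam * v))"
  have q: "0 < q" "q \<le> 1 / 54" using small by (auto simp: q_def)
  define W where "W h = {w. length w = 3 * h + 1 \<and> distinct (crossed 0 w) \<and>
    length (crossed 0 w) = Suc h}" for h
  define V where "V w = {\<omega> \<in> space M. \<forall>u\<in>set (crossed 0 w). X \<omega> \<inter> cell u = {}}" for w
  define F where "F h = (\<Union>w\<in>W h. V w)" for h
  have finW: "finite (W h)" for h
    unfolding W_def by (rule finite_subset[OF _ finite_move_lists[of "3 * h + 1"]]) auto
  have cardW: "card (W h) \<le> 3 ^ (3 * h + 1)" for h
    unfolding W_def card_move_lists[symmetric] by (rule card_mono[OF finite_move_lists]) auto
  have V: "V w \<in> sets M" "measure M (V w) = q ^ card (set (crossed 0 w))" for w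
    unfolding V_def q_def by (rule poisson_cells_void[OF P cell]; simp)+
  have F: "F h \<in> sets M" for h
    unfolding F_def using finW V(1) by auto
  have le: "measure M (F h) \<le> 3 * q * (27 * q) ^ h" for h
  proof -
    have "measure M (F h) \<le> (\<Sum>w\<in>W h. measure M (V w))"
      unfolding F_def by (rule finite_measure_subadditive_finite) (use finW V(1) in auto)
    also have "\<dots> = (\<Sum>w\<in>W h. q ^ Suc h)"
      by (rule sum.cong) (auto simp: V W_def distinct_card)
    also have "\<dots> \<le> 3 ^ (3 * h + 1) * q ^ Suc h"
      using of_nat_mono[OF cardW[of h], where ?'a = real] q by (simp add: mult_right_mono)
    also have "\<dots> = 3 * q * (27 * q) ^ h"
      by (simp add: power_mult power_mult_distrib)
    finally show ?thesis .
  qed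
  have summ: "(\<lambda>h. 3 * q * (27 * q) ^ h) sums (3 * q * (1 / (1 - 27 * q)))"
    by (intro sums_mult geometric_sums) (use q in auto)
  have summF: "summable (\<lambda>h. measure M (F h))"
    by (rule summable_comparison_test'[OF sums_summable[OF summ], of 0]) (use le in auto)
  have "measure M (\<Union>h. F h) \<le> (\<Sum>h. measure M (F h))"
    by (rule finite_measure_subadditive_countably) (use F summF in auto)
  also have "\<dots> \<le> 3 * q * (1 / (1 - 27 * q))"
    unfolding sums_unique[OF summ]
    by (rule suminf_le[OF le summF sums_summable[OF summ]])
  also have "\<dots> \<le> 1 / 4"
    using q by (simp add: field_simps)
  finally have UF: "measure M (\<Union>h. F h) \<le> 1 / 4" .
  have UFs: "(\<Union>h. F h) \<in> sets M" using F by auto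
  show thesis
  proof (rule that[of "space M - (\<Union>h. F h)"])
    show "space M - (\<Union>h. F h) \<in> sets M" using UFs by auto
    show "measure M (space M - (\<Union>h. F h)) \<ge> 3 / 4"
      using UF by (simp add: prob_compl[OF UFs])
    fix \<omega> n assume \<omega>: "\<omega> \<in> space M - (\<Union>h. F h)"
    show "\<not> blocked {u. X \<omega> \<inter> cell u = {}} n 0 0"
    proof
      assume "blocked {u. X \<omega> \<inter> cell u = {}} n 0 0"
      then obtain w h where "length w = 3 * h + 1" "distinct (crossed 0 w)"
        "length (crossed 0 w) = Suc h" "set (crossed 0 w) \<subseteq> {u. X \<omega> \<inter> cell u = {}}"
        by (rule blocked_distinct_walk)
      then have "w \<in> W h" "\<omega> \<in> V w" using \<omega> by (auto simp: W_def V_def)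
      then have "\<omega> \<in> F h" by (auto simp: F_def)
      with \<omega> show False by auto
    qed
  qed
qed

section \<open>Hops and the infinite cluster\<close>

text \<open>\<open>arg_min_on\<close> is informative only if a minimum exists. Local finiteness
  leaves finitely many cluster points no farther from \<open>x\<close> than \<open>y\<close>, and
  the best of them is a global minimum.\<close>

lemma nearest_infinite_least:
  assumes "locally_finite_set S" and "y \<in> infinite_cluster S"
  shows "nearest_infinite S x \<in> infinite_cluster S" and "dist x (nearest_infinite S x) \<le> dist x y"
proof -
  define A where "A = infinite_cluster S \<inter> cball x (dist x y)"
  have "finite A"
    by (rule finite_subset[of _ "S \<inter> cball x (dist x y)"])
      (use assms(1) in \<open>auto simp: A_def infinite_cluster_def locally_finite_set_def\<close>)
  moreover have "A \<noteq> {}"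
    using assms(2) by (auto simp: A_def)
  ultimately obtain z where z: "z \<in> A" "\<forall>a\<in>A. dist x z \<le> dist x a"
    using arg_min_least[of A _ "dist x"] arg_min_if_finite(1)[of A "dist x"] by blast
  have z_min: "dist x z \<le> dist x a" if "a \<in> infinite_cluster S" for a
    using z that by (cases "dist x a \<le> dist x y") (auto simp: A_def)
  have "is_arg_min (dist x) (\<lambda>a. a \<in> infinite_cluster S) (nearest_infinite S x)"
    unfolding nearest_infinite_def arg_min_on_def arg_min_def
    by (rule someI[of _ z]) (use z z_min in \<open>auto simp: is_arg_min_def A_def not_less\<close>)
  then show "nearest_infinite S x \<in> infinite_cluster S" "dist x (nearest_infinite S x) \<le> dist x y"
    using assms(2) by (auto simp: is_arg_min_def not_less)
qed

lemma connected_component_ball_union: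
  assumes "x \<in> S" "y \<in> S" "dist x y \<le> 1"
  shows "connected_component (ball_union S) x y"
proof (rule connected_componentI[of "cball x (1/2) \<union> cball y (1/2)"])
  have "dist x (midpoint x y) \<le> 1/2" "dist y (midpoint x y) \<le> 1/2"
    using assms(3) by (simp_all add: dist_midpoint)
  then have "cball x (1/2) \<inter> cball y (1/2) \<noteq> {}"
    by (metis Int_iff mem_cball empty_iff)
  then show "connected (cball x (1/2) \<union> cball y (1/2))"
    by (intro connected_Un) auto
qed (use assms in \<open>auto simp: ball_union_def\<close>)

lemma connected_component_chain:
  assumes "\<And>k. k \<le> n \<Longrightarrow> p k \<in> S" "\<And>k. k < n \<Longrightarrow> dist (p k) (p (Suc k)) \<le> 1"
  shows "connected_component (ball_union S) (p 0) (p n)"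
  using assms
proof (induction n)
  case 0
  then show ?case by (auto simp: ball_union_def intro!: bexI[of _ "p 0"])
next
  case (Suc n)
  then show ?case
    using connected_component_ball_union[of "p n" S "p (Suc n)"]
    by (meson connected_component_trans le_Suc_eq less_Suc_eq lessI order_refl)
qed

lemma infinite_clusterI:
  assumes "x \<in> S" and "\<And>r. \<exists>y. connected_component (ball_union S) x y \<and> r \<le> norm y"
  shows "x \<in> infinite_cluster S"
proof -
  let ?C = "connected_component_set (ball_union S) x"
  have "x \<in> ball_union S"
    using assms(1) by (auto simp: ball_union_def intro!: bexI[of _ x])
  moreover have "\<not> bounded ?C"
  proof
    assume "bounded ?C"
    then obtain b where "\<And>y. y \<in> ?C \<Longrightarrow> norm y \<le> b"
      by (auto simp: bounded_iff)
    with assms(2)[of "b + 1"] show False by fastforce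
  qed
  ultimately show ?thesis
    using assms(1) unfolding infinite_cluster_def by (auto simp: components_iff intro!: bexI[of _ ?C])
qed

lemma connectable_dist_le:
  assumes "connectable S k x y"
  shows "dist x y \<le> real k"
proof -
  from assms obtain p where p: "p 0 = x" "p k = y" "\<And>j. j < k \<Longrightarrow> dist (p j) (p (Suc j)) \<le> 1"
    by (auto simp: connectable_def)
  have "dist (p 0) (p n) \<le> real n" if "n \<le> k" for n
    using that
  proof (induction n)
    case (Suc n)
    then show ?case
      using p(3)[of n] dist_triangle[of "p 0" "p (Suc n)" "p n"] by simp
  qed simp
  with p show ?thesis by auto
qed

text \<open>Once some hop count is admissible, the infimum in \<open>enat\<close> is attained by the
  least one, so it is finite and itself the length of a chain of hops of length at most 1.\<close>

lemma hop_distance_bounds: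
  assumes "connectable S m x y" "1 \<le> m"
  obtains k where "hop_distance S x y = enat k" "dist x y \<le> real k" "k \<le> m"
proof -
  let ?K = "{k. 1 \<le> k \<and> connectable S k x y}"
  have m: "m \<in> ?K" using assms by simp
  have L: "(LEAST k. k \<in> ?K) \<in> ?K"
    using m by (rule LeastI)
  have "hop_distance S x y = enat (LEAST k. k \<in> ?K)"
    unfolding hop_distance_def
  proof (rule antisym)
    show "(INF k\<in>?K. enat k) \<le> enat (LEAST k. k \<in> ?K)"
      using L by (rule INF_lower)
    show "enat (LEAST k. k \<in> ?K) \<le> (INF k\<in>?K. enat k)"
      by (rule INF_greatest) (simp only: enat_ord_simps Least_le)
  qed
  moreover have "dist x y \<le> real (LEAST k. k \<in> ?K)"
    using L by (intro connectable_dist_le) auto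
  moreover have "(LEAST k. k \<in> ?K) \<le> m"
    using m by (rule Least_le)
  ultimately show thesis by (rule that)
qed

lemma connectable_chain:
  assumes "\<And>k. k \<le> n \<Longrightarrow> p k \<in> S" "\<And>k. k < n \<Longrightarrow> dist (p k) (p (Suc k)) \<le> 1"
    and "dist x (p 0) \<le> 1" "dist (p n) y \<le> 1"
  shows "connectable S (n + 2) x y"
proof -
  \<comment> \<open>The index shift makes room for \<open>x\<close>: \<open>n\<close> hops join
    \<open>p 0\<close> to \<open>p n\<close>, with one more hop at each end.\<close>
  define r where "r j = (if j = 0 then x else if j = n + 2 then y else p (j - 1))" for j
  have "dist (r j) (r (Suc j)) \<le> 1" if j: "j < n + 2" for j
  proof -
    consider "j = 0" | "j = Suc n" | "0 < j" "j \<le> n"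
      using j by (cases "j = 0"; cases "j = Suc n") auto
    then show ?thesis
    proof cases
      case 3
      then show ?thesis
        using assms(2)[of "j - 1"] by (simp add: r_def)
    qed (use assms in \<open>simp_all add: r_def\<close>)
  qed
  moreover have "r j \<in> S" if "1 \<le> j" "j < n + 2" for j
    using that assms(1)[of "j - 1"] by (auto simp: r_def)
  ultimately show ?thesis
    unfolding connectable_def by (intro exI[of _ r]) (auto simp: r_def)
qed

text \<open>From left to right the forward path \<open>f\<close> never descends and the backward path \<open>b\<close> never climbs.
  In the first column where \<open>f\<close> is not below \<open>b\<close> they have met or just crossed, so one can switch from
  \<open>f\<close> to \<open>b\<close> there with a step of at most one row.\<close>

lemma glue_paths:
  fixes f b :: "nat \<Rightarrow> int"
  assumes f: "f 0 = 0" "\<And>k. k < N \<Longrightarrow> f (Suc k) = f k \<or> f (Suc k) = f k + 1"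
    and b: "b N = 0" "\<And>k. k < N \<Longrightarrow> b k = b (Suc k) \<or> b k = b (Suc k) + 1"
  obtains g :: "nat \<Rightarrow> int" where "g 0 = 0" "g N = 0" "\<And>k. k < N \<Longrightarrow> \<bar>g (Suc k) - g k\<bar> \<le> 1"
    "\<And>k. k \<le> N \<Longrightarrow> g k = f k \<or> g k = b k"
proof -
  have f_nonneg: "0 \<le> f k" if "k \<le> N" for k
    using that
  proof (induction k)
    case (Suc k)
    then show ?case using f(2)[of k] by auto
  qed (use f in simp)
  have b_nonneg: "0 \<le> b k" if "k \<le> N" for k
    using that
  proof (induction rule: inc_induct)
    case (step k)
    then show ?case using b(2)[of k] by auto
  qed (use b in simp)
  define m where "m = (LEAST k. b k \<le> f k)"
  have "b N \<le> f N" using f_nonneg[of N] b(1) by simp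
  then have m: "m \<le> N" "b m \<le> f m"
    unfolding m_def by (auto intro: Least_le LeastI)
  have before: "f k < b k" if "k < m" for k
    using not_less_Least[of k "\<lambda>k. b k \<le> f k"] that by (simp add: m_def)
  define g where "g k = (if k < m then f k else b k)" for k
  show thesis
  proof (rule that[of g])
    show "g 0 = 0"
      using f(1) b_nonneg[of 0] m by (auto simp: g_def intro: antisym)
    show "g N = 0"
      using b(1) m(1) by (simp add: g_def)
    show "\<bar>g (Suc k) - g k\<bar> \<le> 1" if "k < N" for k
    proof -
      consider "Suc k < m" | "m \<le> k" | "Suc k = m" by linarith
      then show ?thesis
      proof cases
        case 3
        then show ?thesis
          using f(2)[OF that] b(2)[OF that] before[of k] m(2) by (auto simp: g_def)
      qed (use f(2)[OF that] b(2)[OF that] in \<open>auto simp: g_def\<close>)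
    qed
  qed (auto simp: g_def)
qed

section \<open>Cubes and the time constant\<close>

context
  fixes e1 e2 :: "'a::euclidean_space" and s \<epsilon> :: real
  assumes Basis: "e1 \<in> Basis" "e2 \<in> Basis" "e1 \<noteq> e2"
    and \<epsilon>: "0 < \<epsilon>" "\<epsilon> \<le> s" and step: "s + (real DIM('a) + 1) * \<epsilon> \<le> 1"
begin

definition centre :: "int \<times> int \<Rightarrow> 'a" where
  "centre u = (of_int (fst u) * s) *\<^sub>R e1 + (of_int (snd u) * \<epsilon>) *\<^sub>R e2"

text \<open>The cubes are open because rows are exactly \<open>\<epsilon>\<close> apart: closed
  cubes in neighbouring rows would share a face.\<close>

definition cell :: "int \<times> int \<Rightarrow> 'a set" where
  "cell u = box (centre u - (\<epsilon> / 2) *\<^sub>R One) (centre u + (\<epsilon> / 2) *\<^sub>R One)"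

lemma mem_cell: "x \<in> cell u \<longleftrightarrow> (\<forall>b\<in>Basis. \<bar>(x - centre u) \<bullet> b\<bar> < \<epsilon> / 2)"
  unfolding cell_def mem_box
  by (intro ball_cong refl) (auto simp: inner_diff_left inner_add_left abs_if field_simps)

lemma centre_inner:
  "centre u \<bullet> e1 = of_int (fst u) * s" "centre u \<bullet> e2 = of_int (snd u) * \<epsilon>"
  using Basis by (auto simp: centre_def inner_add_left inner_not_same_Basis)

lemma measure_cell: "measure lborel (cell u) = \<epsilon> ^ DIM('a)"
  using \<epsilon>(1) unfolding cell_def
  by (subst measure_lborel_box) (auto simp: algebra_simps inner_diff_left)

text \<open>A number cannot lie within \<open>\<epsilon> / 2\<close> of two distinct multiples of
  some \<open>r \<ge> \<epsilon>\<close>. This is applied along \<open>e1\<close> with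
  \<open>r = s\<close> and along \<open>e2\<close> with \<open>r = \<epsilon>\<close>.\<close>

lemma cell_disjoint:
  assumes "x \<in> cell u" "x \<in> cell v"
  shows "u = v"
proof -
  have eq: "i = j" if "\<bar>y - of_int i * r\<bar> < \<epsilon> / 2" "\<bar>y - of_int j * r\<bar> < \<epsilon> / 2" "\<epsilon> \<le> r"
    for i j :: int and y r :: real
  proof (rule ccontr)
    assume "i \<noteq> j"
    then have "1 \<le> \<bar>real_of_int i - of_int j\<bar>" by linarith
    then have "r \<le> \<bar>real_of_int i - of_int j\<bar> * r"
      using \<epsilon>(1) that(3) by simp
    also have "\<dots> = \<bar>of_int i * r - of_int j * r\<bar>"
      using \<epsilon>(1) that(3) by (simp add: left_diff_distrib[symmetric] abs_mult)
    also have "\<dots> < \<epsilon>" using that(1,2) by linarith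
    finally show False using that(3) by simp
  qed
  have "\<bar>x \<bullet> b - centre u \<bullet> b\<bar> < \<epsilon> / 2" "\<bar>x \<bullet> b - centre v \<bullet> b\<bar> < \<epsilon> / 2"
    if "b \<in> Basis" for b
    using assms that by (auto simp: mem_cell inner_diff_left)
  from this[OF Basis(1)] this[OF Basis(2)] show ?thesis
    using \<epsilon>(2) by (auto simp: prod_eq_iff centre_inner intro: eq)
qed

lemma dist_cell_centre:
  assumes "x \<in> cell u"
  shows "dist x (centre u) \<le> real DIM('a) * \<epsilon> / 2"
proof -
  have "norm (x - centre u) \<le> (\<Sum>b\<in>Basis. \<bar>(x - centre u) \<bullet> b\<bar>)"
    by (rule norm_le_l1)
  also have "\<dots> \<le> (\<Sum>b\<in>(Basis :: 'a set). \<epsilon> / 2)"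
    using assms by (intro sum_mono) (auto simp: mem_cell intro: less_imp_le)
  finally show ?thesis by (simp add: dist_norm)
qed

text \<open>The centres are at most \<open>s + \<epsilon>\<close> apart and each point is within
  \<open>DIM('a) * \<epsilon> / 2\<close> of its centre; the total is the left side of
  \<open>step\<close>.\<close>

lemma dist_adjacent_cells:
  assumes "x \<in> cell (i, j)" "y \<in> cell (i + 1, j')" "\<bar>j' - j\<bar> \<le> 1"
  shows "dist x y \<le> 1"
proof -
  have "norm (centre (i, j) - centre (i + 1, j')) \<le> s + \<epsilon>"
  proof -
    have "centre (i, j) - centre (i + 1, j') = - (s *\<^sub>R e1) + (of_int (j - j') * \<epsilon>) *\<^sub>R e2"
      by (simp add: centre_def algebra_simps)
    then have "norm (centre (i, j) - centre (i + 1, j')) \<le> norm (s *\<^sub>R e1) + norm ((of_int (j - j') * \<epsilon>) *\<^sub>R e2)"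
      by (metis norm_minus_cancel norm_triangle_ineq)
    also have "\<dots> = s + \<bar>of_int (j - j')\<bar> * \<epsilon>"
      using Basis \<epsilon> by (simp add: abs_mult)
    also have "\<dots> \<le> s + 1 * \<epsilon>"
      using assms(3) \<epsilon>(1) by (intro add_left_mono mult_right_mono) linarith+
    finally show ?thesis by simp
  qed
  moreover have "dist x y \<le> dist x (centre (i, j)) + dist (centre (i, j)) (centre (i + 1, j'))
      + dist y (centre (i + 1, j'))"
    using dist_triangle[of x y "centre (i, j)"]
      dist_triangle2[of "centre (i, j)" y "centre (i + 1, j')"] by linarith
  ultimately show ?thesis
    using dist_cell_centre[OF assms(1)] dist_cell_centre[OF assms(2)] step
    by (simp add: dist_norm algebra_simps)
qed

text \<open>Reflecting columns by \<open>int N - fst u\<close> lets the same oriented percolation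
  run leftwards from \<open>(int N, 0)\<close>. Forward survival at every depth puts the point at
  the origin into the infinite cluster, and the glued path carries this over to the other
  end.\<close>

lemma hop_distance_survival:
  assumes S: "locally_finite_set S"
    and fwd: "\<And>n. \<not> blocked {u. S \<inter> cell u = {}} n 0 0"
    and bwd: "\<not> blocked {u. S \<inter> cell (int N - fst u, snd u) = {}} N 0 0"
  obtains k where
    "hop_distance S (nearest_infinite S 0) (nearest_infinite S ((real N * s) *\<^sub>R e1)) = enat k"
    "real N * s - 1 \<le> real k" "k \<le> N + 2"
proof -
  define z where "z = (real N * s) *\<^sub>R e1"
  \<comment> \<open>One point is fixed per nonempty cell, so paths through a common cell share its
    point.\<close>
  define r where "r u = (SOME x. x \<in> S \<inter> cell u)" for u
  have r: "r u \<in> S" "r u \<in> cell u" if "S \<inter> cell u \<noteq> {}" for u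
    using someI_ex[of "\<lambda>x. x \<in> S \<inter> cell u"] that unfolding r_def by blast+
  have "\<exists>f :: nat \<Rightarrow> int. f 0 = 0 \<and> (\<forall>k<n. f (Suc k) = f k \<or> f (Suc k) = f k + 1) \<and>
      (\<forall>k\<le>n. S \<inter> cell (int k, f k) \<noteq> {})" for n
    using not_blocked_path[OF fwd[of n]] by simp
  then obtain f :: "nat \<Rightarrow> nat \<Rightarrow> int" where f: "\<And>n. f n 0 = 0"
    "\<And>n k. k < n \<Longrightarrow> f n (Suc k) = f n k \<or> f n (Suc k) = f n k + 1"
    "\<And>n k. k \<le> n \<Longrightarrow> S \<inter> cell (int k, f n k) \<noteq> {}"
    by metis
  obtain b' :: "nat \<Rightarrow> int" where b': "b' 0 = 0"
    "\<And>k. k < N \<Longrightarrow> b' (Suc k) = b' k \<or> b' (Suc k) = b' k + 1"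
    "\<And>k. k \<le> N \<Longrightarrow> S \<inter> cell (int N - int k, b' k) \<noteq> {}"
    using not_blocked_path[OF bwd] by auto
  define b where "b k = b' (N - k)" for k
  have b: "b N = 0" "\<And>k. k < N \<Longrightarrow> b k = b (Suc k) \<or> b k = b (Suc k) + 1"
    "\<And>k. k \<le> N \<Longrightarrow> S \<inter> cell (int k, b k) \<noteq> {}"
  proof -
    show "b N = 0" using b'(1) by (simp add: b_def)
    show "b k = b (Suc k) \<or> b k = b (Suc k) + 1" if "k < N" for k
      using b'(2)[of "N - Suc k"] that by (auto simp: b_def Suc_diff_Suc)
    show "S \<inter> cell (int k, b k) \<noteq> {}" if "k \<le> N" for k
      using b'(3)[of "N - k"] that by (simp add: b_def of_nat_diff)
  qed
  obtain g where g: "g 0 = 0" "g N = 0" "\<And>k. k < N \<Longrightarrow> \<bar>g (Suc k) - g k\<bar> \<le> 1"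
    "\<And>k. k \<le> N \<Longrightarrow> g k = f N k \<or> g k = b k"
    using glue_paths[of "f N" N b, OF f(1) f(2) b(1,2)] by blast
  have "S \<inter> cell (int k, g k) \<noteq> {}" if "k \<le> N" for k
    using g(4)[OF that] f(3)[OF that] b(3)[OF that] by (elim disjE) simp_all
  then have g_S: "r (int k, g k) \<in> S" "r (int k, g k) \<in> cell (int k, g k)" if "k \<le> N" for k
    using r[of "(int k, g k)"] that by blast+
  have g_dist: "dist (r (int k, g k)) (r (int (Suc k), g (Suc k))) \<le> 1" if "k < N" for k
    using dist_adjacent_cells[of _ "int k" "g k" _ "g (Suc k)"] g_S(2)[of k] g_S(2)[of "Suc k"]
      g(3)[OF that] that by (simp add: add.commute)
  \<comment> \<open>Each \<open>R\<close> gets its own finite path: all \<open>f n\<close> start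
    from the same point \<open>r 0\<close>, and the end of \<open>f n\<close> has
    \<open>e1\<close>-coordinate at least \<open>real n * s - \<epsilon>\<close>.\<close>
  have far: "\<exists>y. connected_component (ball_union S) (r 0) y \<and> R \<le> norm y" for R
  proof -
    obtain n :: nat where n: "(R + \<epsilon>) / s < real n" using reals_Archimedean2 by blast
    have fS: "r (int k, f n k) \<in> S" "r (int k, f n k) \<in> cell (int k, f n k)" if "k \<le> n" for k
      using r[OF f(3)[OF that]] .
    have "connected_component (ball_union S) (r (int 0, f n 0)) (r (int n, f n n))"
    proof (rule connected_component_chain[where p = "\<lambda>k. r (int k, f n k)"])
      show "dist (r (int k, f n k)) (r (int (Suc k), f n (Suc k))) \<le> 1" if "k < n" for k
        using dist_adjacent_cells[of _ "int k" "f n k" _ "f n (Suc k)"] fS(2)[of k]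
          fS(2)[of "Suc k"] f(2)[OF that] that by (auto simp: add.commute)
    qed (use fS in auto)
    moreover have "R \<le> norm (r (int n, f n n))"
    proof -
      have "\<bar>(r (int n, f n n) - centre (int n, f n n)) \<bullet> e1\<bar> < \<epsilon> / 2"
        using fS(2)[of n] Basis by (auto simp: mem_cell)
      moreover have "(r (int n, f n n) - centre (int n, f n n)) \<bullet> e1 =
          r (int n, f n n) \<bullet> e1 - real n * s"
        by (simp add: inner_diff_left centre_inner)
      ultimately have "real n * s - \<epsilon> \<le> r (int n, f n n) \<bullet> e1"
        using \<epsilon>(1) by linarith
      also have "\<dots> \<le> norm (r (int n, f n n))"
        using Basis_le_norm[OF Basis(1)] by (meson abs_ge_self order_trans)
      finally have "real n * s - \<epsilon> \<le> norm (r (int n, f n n))" .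
      moreover have "R + \<epsilon> < real n * s"
        using n \<epsilon> by (simp add: field_simps)
      ultimately show ?thesis by simp
    qed
    ultimately show ?thesis
      using f(1)[of n] by (auto simp: zero_prod_def)
  qed
  have conn: "connected_component (ball_union S) (r 0) (r (int N, 0))"
    using connected_component_chain[of N "\<lambda>k. r (int k, g k)" S] g_S g_dist g(1,2)
    by (simp add: zero_prod_def)
  have x0: "r 0 \<in> infinite_cluster S"
    using g_S(1)[of 0] g(1) far by (intro infinite_clusterI) (auto simp: zero_prod_def)
  have xN: "r (int N, 0) \<in> infinite_cluster S"
  proof (rule infinite_clusterI)
    show "\<exists>y. connected_component (ball_union S) (r (int N, 0)) y \<and> R \<le> norm y" for R
      using far[of R] conn connected_component_trans connected_component_sym by blast
  qed (use g_S(1)[of N] g(2) in simp)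
  define p q where "p = nearest_infinite S 0" and "q = nearest_infinite S z"
  \<comment> \<open>The cell points at both ends lie within 1/2 of \<open>0\<close> and
    \<open>z\<close>, hence so do the nearest cluster points. Two halves make one extra hop at each
    end, and cost 1 in total in the lower bound.\<close>
  have small: "real DIM('a) * \<epsilon> / 2 \<le> 1 / 2"
    using step \<epsilon> by (simp add: algebra_simps)
  have r0: "dist 0 (r 0) \<le> 1 / 2"
    using dist_cell_centre[OF g_S(2)[of 0]] small g(1)
    by (simp add: zero_prod_def[symmetric] centre_def dist_commute)
  have rN: "dist z (r (int N, 0)) \<le> 1 / 2"
    using dist_cell_centre[OF g_S(2)[of N]] small g(2)
    by (simp add: centre_def z_def dist_commute)
  have p: "dist 0 p \<le> 1 / 2"
    using nearest_infinite_least(2)[OF S x0, of 0] r0 unfolding p_def by linarith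
  have q: "dist z q \<le> 1 / 2"
    using nearest_infinite_least(2)[OF S xN, of z] rN unfolding q_def by linarith
  have "connectable S (N + 2) p q"
  proof (rule connectable_chain[where p = "\<lambda>k. r (int k, g k)"])
    show "dist p (r (int 0, g 0)) \<le> 1"
      using dist_triangle3[of p "r 0" 0] p r0 g(1) by (simp add: zero_prod_def[symmetric])
    show "dist (r (int N, g N)) q \<le> 1"
      using dist_triangle3[of "r (int N, 0)" q z] q rN g(2) by simp
  qed (use g_S g_dist in auto)
  then obtain k where k: "hop_distance S p q = enat k" "dist p q \<le> real k" "k \<le> N + 2"
    by (rule hop_distance_bounds) simp
  have "real N * s = dist 0 z"
    using Basis \<epsilon> by (simp add: z_def)
  also have "\<dots> \<le> dist 0 p + dist p q + dist z q"
    using dist_triangle[of 0 z p] dist_triangle2[of p z q] by linarith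
  finally have "real N * s - 1 \<le> real k" using p q k(2) by linarith
  then show thesis
    using k(1,3) that unfolding p_def q_def z_def by simp
qed

text \<open>The reflected cells are again disjoint and of equal volume, so survival has probability
  at least 3/4 in either direction. The two events may be dependent, but both occur with probability
  at least 3/4 + 3/4 - 1.\<close>

lemma survival_event_both_ends:
  fixes X :: "'w \<Rightarrow> 'a set"
  assumes P: "poisson_process M lam X" and small: "exp (- (lam * \<epsilon> ^ DIM('a))) \<le> 1 / 54"
  obtains E where "E \<in> sets M" "measure M E \<ge> 1 / 2"
    "\<And>\<omega>. \<omega> \<in> E \<Longrightarrow> \<exists>k. hop_distance (X \<omega>) (nearest_infinite (X \<omega>) 0)
        (nearest_infinite (X \<omega>) ((real N * s) *\<^sub>R e1)) = enat k \<and>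
      real N * s - 1 \<le> real k \<and> k \<le> N + 2"
proof -
  interpret prob_space M using P by (simp add: poisson_process_def)
  have cell: "cell u \<in> sets borel" "bounded (cell u)" for u
    by (auto simp: cell_def)
  have disj: "disjoint_family cell"
    using cell_disjoint by (auto simp: disjoint_family_on_def)
  have disj': "disjoint_family (\<lambda>u. cell (int N - fst u, snd u))"
    unfolding disjoint_family_on_def
  proof (intro ballI impI equals0I)
    fix u v :: "int \<times> int" and x
    assume "u \<noteq> v" "x \<in> cell (int N - fst u, snd u) \<inter> cell (int N - fst v, snd v)"
    then show False
      using cell_disjoint[of x "(int N - fst u, snd u)" "(int N - fst v, snd v)"]
      by (auto simp: prod_eq_iff)
  qed
  obtain E1 where E1: "E1 \<in> sets M" "measure M E1 \<ge> 3 / 4"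
    "\<And>\<omega> n. \<omega> \<in> E1 \<Longrightarrow> \<not> blocked {u. X \<omega> \<inter> cell u = {}} n 0 0"
    by (rule survival_event[OF P cell disj measure_cell small]) blast
  obtain E2 where E2: "E2 \<in> sets M" "measure M E2 \<ge> 3 / 4"
    "\<And>\<omega> n. \<omega> \<in> E2 \<Longrightarrow> \<not> blocked {u. X \<omega> \<inter> cell (int N - fst u, snd u) = {}} n 0 0"
    by (rule survival_event[OF P cell disj' measure_cell small]) blast
  show thesis
  proof (rule that[of "E1 \<inter> E2"])
    show "E1 \<inter> E2 \<in> sets M" using E1 E2 by auto
    have "measure M (E1 \<union> E2) = measure M E1 + measure M E2 - measure M (E1 \<inter> E2)"
      using measure_Un3[of E1 M E2] E1(1) E2(1) by (simp add: fmeasurable_eq_sets)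
    then show "measure M (E1 \<inter> E2) \<ge> 1 / 2"
      using prob_le_1[of "E1 \<union> E2"] E1(2) E2(2) by linarith
    fix \<omega> assume \<omega>: "\<omega> \<in> E1 \<inter> E2"
    then have "locally_finite_set (X \<omega>)"
      using P sets.sets_into_space[OF E1(1)] by (auto simp: poisson_process_def)
    then show "\<exists>k. hop_distance (X \<omega>) (nearest_infinite (X \<omega>) 0)
        (nearest_infinite (X \<omega>) ((real N * s) *\<^sub>R e1)) = enat k \<and>
      real N * s - 1 \<le> real k \<and> k \<le> N + 2"
      by (rule hop_distance_survival[of "X \<omega>" N]) (use \<omega> E1(3) E2(3) in auto)
  qed
qed

end

section \<open>From fixed \<open>n\<close> to the limit\<close>

lemma (in prob_space) AE_infinitely_often:
  assumes E: "\<And>n. n \<ge> n0 \<Longrightarrow> E n \<in> events" "\<And>n. n \<ge> n0 \<Longrightarrow> c \<le> prob (E n)" and "0 < c"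
    and AE: "AE \<omega> in M. P \<omega>"
  obtains \<omega> where "\<omega> \<in> space M" "P \<omega>" "\<exists>\<^sub>F n in sequentially. \<omega> \<in> E n"
proof -
  \<comment> \<open>The tail unions decrease and each has probability at least \<open>c\<close>. So
    has their intersection, the event that \<open>E n\<close> occurs infinitely often, which
    therefore does not fit into a null set.\<close>
  define B where "B m = (\<Union>n\<in>{max n0 m..}. E n)" for m
  have B: "range B \<subseteq> events"
    using E(1) by (auto simp: B_def intro!: sets.countable_UN'')
  have dec: "decseq B"
    unfolding B_def decseq_def by (intro allI impI UN_mono) auto
  have "c \<le> prob (B m)" for m
    using E(2)[of "max n0 m"] finite_measure_mono[of "E (max n0 m)" "B m"] B
    by (force simp: B_def)
  then have "c \<le> prob (\<Inter>m. B m)"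
    by (intro LIMSEQ_le_const[OF finite_Lim_measure_decseq[OF B dec]]) auto
  then have pos: "0 < prob (\<Inter>m. B m)" using \<open>0 < c\<close> by simp
  from AE obtain Z where Z: "{\<omega> \<in> space M. \<not> P \<omega>} \<subseteq> Z" "Z \<in> null_sets M"
    by (auto simp: eventually_ae_filter)
  have "\<not> (\<Inter>m. B m) \<subseteq> Z"
  proof
    assume "(\<Inter>m. B m) \<subseteq> Z"
    then have "prob (\<Inter>m. B m) \<le> prob Z"
      using Z(2) by (intro finite_measure_mono) auto
    with pos Z(2) show False by (auto simp: measure_eq_0_null_sets)
  qed
  then obtain \<omega> where \<omega>: "\<omega> \<in> (\<Inter>m. B m)" "\<omega> \<notin> Z" by blast
  have "\<omega> \<in> space M"
    using \<omega>(1) B sets.sets_into_space by blast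
  moreover have "\<exists>\<^sub>F n in sequentially. \<omega> \<in> E n"
    using \<omega>(1) by (force simp: frequently_sequentially B_def)
  ultimately show thesis
    using that \<omega>(2) Z(1) by blast
qed

text \<open>As \<open>\<mu>\<close> is deterministic, one outcome with infinitely many good
  \<open>n\<close> bounds it. There the hop count lies between \<open>n - 1\<close> and
  \<open>n / (1 - t) + 3\<close>; dividing by \<open>n\<close> removes the additive
  constants.\<close>

lemma time_constant_bounds:
  fixes X :: "'w \<Rightarrow> 'a::euclidean_space set" and e1 :: 'a
  assumes P: "poisson_process M lam X" and tc: "time_constant M X e1 \<mu>"
    and dim: "DIM('a) \<ge> 2" and e1: "e1 \<in> Basis"
    and \<epsilon>: "0 < \<epsilon>" "(real DIM('a) + 1) * \<epsilon> \<le> 1 / 2"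
    and small: "exp (- (lam * \<epsilon> ^ DIM('a))) \<le> 1 / 54"
  shows "1 \<le> \<mu>" and "\<mu> \<le> 1 + 2 * (real DIM('a) + 1) * \<epsilon>"
proof -
  interpret prob_space M using P by (simp add: poisson_process_def)
  obtain e2 :: 'a where e2: "e2 \<in> Basis" "e1 \<noteq> e2"
  proof -
    have "card (Basis :: 'a set) \<noteq> card {e1}" using dim by simp
    then have "Basis \<noteq> {e1}" by metis
    with e1 that show thesis by blast
  qed
  define t where "t = (real DIM('a) + 1) * \<epsilon>"
  have t: "0 < t" "t \<le> 1 / 2" using \<epsilon> by (auto simp: t_def)
  have \<epsilon>_le: "6 * \<epsilon> \<le> 2 * t"
    using mult_right_mono[of 3 "real DIM('a) + 1" \<epsilon>] dim \<epsilon>(1) by (simp add: t_def)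
  define H where "H \<omega> n = hop_distance (X \<omega>) (nearest_infinite (X \<omega>) 0)
      (nearest_infinite (X \<omega>) (real n *\<^sub>R e1))" for \<omega> n
  define good where "good \<omega> n \<longleftrightarrow> (\<exists>k. H \<omega> n = enat k \<and> real n - 1 \<le> real k \<and>
      real k \<le> real n / (1 - t) + 3)" for \<omega> and n :: nat
  have "\<exists>E. E \<in> events \<and> 1 / 2 \<le> prob E \<and> (\<forall>\<omega>\<in>E. good \<omega> n)" if n: "n \<ge> 2" for n
  proof -
    \<comment> \<open>\<open>N\<close> is the least number of columns with spacing at most
      \<open>1 - t\<close>; the exact spacing \<open>s = n / N\<close> centres the cell
      \<open>(int N, 0)\<close> at \<open>real n *\<^sub>R e1\<close>.\<close>
    define N where "N = nat \<lceil>real n / (1 - t)\<rceil>"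
    have pos: "0 < real n / (1 - t)" using n t by simp
    then have "real N = of_int \<lceil>real n / (1 - t)\<rceil>"
      unfolding N_def by (intro of_nat_nat) linarith
    then have N: "real n / (1 - t) \<le> real N" "real N \<le> real n / (1 - t) + 1"
      by linarith+
    define s where "s = real n / real N"
    have N0: "0 < real N" using pos N(1) by linarith
    have s: "real N * s = real n" "s \<le> 1 - t"
      using N(1) N0 t by (auto simp: s_def field_simps)
    \<comment> \<open>The context also requires \<open>\<epsilon> \<le> s\<close>: here
      \<open>N \<le> 3 * n\<close> gives \<open>s \<ge> 1 / 3\<close>, while dimension at least 2
      gives \<open>\<epsilon> \<le> 1 / 6\<close>.\<close>
    have "real N \<le> 2 * real n + 1"
    proof -
      have "real n / (1 - t) \<le> real n / (1 / 2)"
        using t n by (intro divide_left_mono) auto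
      with N(2) show ?thesis by simp
    qed
    then have "real N \<le> 3 * real n" using n by linarith
    then have "1 / 3 \<le> s" using N0 by (simp add: s_def field_simps)
    moreover have "\<epsilon> \<le> 1 / 6" using \<epsilon>_le t by linarith
    ultimately have \<epsilon>_s: "\<epsilon> \<le> s" by linarith
    have step: "s + (real DIM('a) + 1) * \<epsilon> \<le> 1" using s(2) by (simp add: t_def)
    obtain E where E: "E \<in> events" "1 / 2 \<le> prob E"
      "\<And>\<omega>. \<omega> \<in> E \<Longrightarrow> \<exists>k. H \<omega> n = enat k \<and> real n - 1 \<le> real k \<and> k \<le> N + 2"
      unfolding H_def
      by (rule survival_event_both_ends[OF e1 e2 \<epsilon>(1) \<epsilon>_s step P small, of N, unfolded s(1)]) blast
    show ?thesis
    proof (intro exI conjI ballI)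
      fix \<omega> assume "\<omega> \<in> E"
      from E(3)[OF this] obtain k where k: "H \<omega> n = enat k" "real n - 1 \<le> real k" "k \<le> N + 2"
        by blast
      have "real k \<le> real N + 2" using k(3) by linarith
      with k N(2) show "good \<omega> n" by (auto simp: good_def)
    qed (use E in auto)
  qed
  then obtain E where E: "\<And>n. n \<ge> 2 \<Longrightarrow> E n \<in> events" "\<And>n. n \<ge> 2 \<Longrightarrow> 1 / 2 \<le> prob (E n)"
    "\<And>n \<omega>. n \<ge> 2 \<Longrightarrow> \<omega> \<in> E n \<Longrightarrow> good \<omega> n"
    by metis
  have "AE \<omega> in M. (\<lambda>n. ereal_of_enat (H \<omega> n) / ereal (real n)) \<longlonglongrightarrow> ereal \<mu>"
    using tc by (simp add: time_constant_def H_def)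
  then obtain \<omega> where
    lim: "(\<lambda>n. ereal_of_enat (H \<omega> n) / ereal (real n)) \<longlonglongrightarrow> ereal \<mu>" and
    freq: "\<exists>\<^sub>F n in sequentially. \<omega> \<in> E n"
    by (rule AE_infinitely_often[of 2 E "1 / 2", rotated 3]) (use E(1,2) in auto)
  have "\<exists>n\<ge>m. n \<ge> 2 \<and> good \<omega> n" for m
  proof -
    obtain n where "n \<ge> max m 2" "\<omega> \<in> E n"
      using freq unfolding frequently_sequentially by blast
    then show ?thesis using E(3) by (intro exI[of _ n]) auto
  qed
  \<comment> \<open>\<open>r\<close> may repeat values, but \<open>r m \<ge> m\<close> makes it tend
    to infinity, so the limit can be taken along it.\<close>
  then obtain r :: "nat \<Rightarrow> nat" where r: "\<And>m. r m \<ge> m" "\<And>m. r m \<ge> 2" "\<And>m. good \<omega> (r m)"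
    by metis
  then obtain k :: "nat \<Rightarrow> nat" where k: "\<And>m. H \<omega> (r m) = enat (k m)"
    "\<And>m. real (r m) - 1 \<le> real (k m)" "\<And>m. real (k m) \<le> real (r m) / (1 - t) + 3"
    unfolding good_def by metis
  have r_top: "filterlim r at_top sequentially"
    by (rule filterlim_at_top_mono[OF filterlim_ident]) (use r(1) in auto)
  have "ereal_of_enat (H \<omega> (r m)) / ereal (real (r m)) = ereal (real (k m) / real (r m))" for m
    using r(2)[of m] by (simp add: k(1))
  with filterlim_compose[OF lim r_top]
  have lim_k: "(\<lambda>m. real (k m) / real (r m)) \<longlonglongrightarrow> \<mu>" by simp
  have inv: "(\<lambda>m. 1 / real (r m)) \<longlonglongrightarrow> 0"
    by (rule filterlim_compose[OF lim_1_over_n r_top])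
  have "(\<lambda>m. 1 - 1 / real (r m)) \<longlonglongrightarrow> 1 - 0"
    by (intro tendsto_intros inv)
  moreover have "1 - 1 / real (r m) \<le> real (k m) / real (r m)" for m
    using divide_right_mono[OF k(2)[of m], of "real (r m)"] r(2)[of m]
    by (simp add: diff_divide_distrib)
  ultimately show "1 \<le> \<mu>"
    using LIMSEQ_le[OF _ lim_k, of "\<lambda>m. 1 - 1 / real (r m)" 1] by auto
  have "(\<lambda>m. 1 / (1 - t) + 3 * (1 / real (r m))) \<longlonglongrightarrow> 1 / (1 - t) + 3 * 0"
    by (intro tendsto_intros inv)
  moreover have "real (k m) / real (r m) \<le> 1 / (1 - t) + 3 * (1 / real (r m))" for m
  proof -
    have "real (k m) / real (r m) \<le> (real (r m) / (1 - t) + 3) / real (r m)"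
      using k(3)[of m] by (intro divide_right_mono) auto
    also have "\<dots> = 1 / (1 - t) + 3 * (1 / real (r m))"
      using r(2)[of m] by (simp add: add_divide_distrib)
    finally show ?thesis .
  qed
  ultimately have "\<mu> \<le> 1 / (1 - t)"
    using LIMSEQ_le[OF lim_k, of "\<lambda>m. 1 / (1 - t) + 3 * (1 / real (r m))" "1 / (1 - t)"] by auto
  also have "1 / (1 - t) \<le> 1 + 2 * t"
  proof -
    \<comment> \<open>This product is \<open>(1 + 2 * t) * (1 - t) - 1\<close>.\<close>
    have "0 \<le> t * (1 - 2 * t)" using t by simp
    then show ?thesis using t by (simp add: field_simps)
  qed
  finally show "\<mu> \<le> 1 + 2 * (real DIM('a) + 1) * \<epsilon>"
    by (simp add: t_def algebra_simps)
qed

theorem theorem6: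
  fixes M :: "real \<Rightarrow> 'w measure"
    and X :: "real \<Rightarrow> 'w \<Rightarrow> 'a::euclidean_space set"
    and \<mu> :: "real \<Rightarrow> real"
    and e1 :: 'a
  assumes "DIM('a) \<ge> 2"
    and "e1 \<in> Basis"
    and "\<And>lam. lam > critical_intensity TYPE('a) \<Longrightarrow> poisson_process (M lam) lam (X lam)"
    and "\<And>lam. lam > critical_intensity TYPE('a) \<Longrightarrow> time_constant (M lam) (X lam) e1 (\<mu> lam)"
  shows "(\<lambda>lam. \<mu> lam - 1) \<in>
    O[at_top](\<lambda>lam. lam powr (- 1 / real DIM('a)) * ln lam powr (1 / real DIM('a)))"
proof -
  define d where "d = real DIM('a)"
  have d: "0 < d" by (simp add: d_def)
  define \<epsilon> where "\<epsilon> lam = lam powr (- 1 / d) * ln lam powr (1 / d)" for lam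
  have "(\<epsilon> \<longlongrightarrow> 0) at_top"
    unfolding \<epsilon>_def using d by real_asymp
  then have "\<forall>\<^sub>F lam in at_top. \<epsilon> lam < 1 / (2 * (d + 1))"
    by (rule order_tendstoD) (use d in simp)
  \<comment> \<open>Beyond 54 a cell is empty with probability \<open>1 / lam < 1 / 54\<close>.
    Since \<open>1 \<le> \<mu> lam\<close>, the norm is \<open>\<mu> lam - 1\<close> itself.\<close>
  then have "\<forall>\<^sub>F lam in at_top. norm (\<mu> lam - 1) \<le> 2 * (d + 1) * norm (\<epsilon> lam)"
    using eventually_gt_at_top[of "max 54 (critical_intensity TYPE('a))"]
  proof eventually_elim
    case (elim lam)
    have lam: "54 < lam" "critical_intensity TYPE('a) < lam" using elim by auto
    have pos: "0 < \<epsilon> lam" using lam(1) by (simp add: \<epsilon>_def)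
    have "\<epsilon> lam ^ DIM('a) = \<epsilon> lam powr d"
      using pos by (simp add: powr_realpow d_def)
    also have "\<dots> = ln lam / lam"
      using lam(1) d by (simp add: \<epsilon>_def powr_mult powr_divide powr_powr powr_minus field_simps)
    finally have "exp (- (lam * \<epsilon> lam ^ DIM('a))) \<le> 1 / 54"
      using lam(1) by (simp add: exp_minus field_simps)
    moreover have "(real DIM('a) + 1) * \<epsilon> lam \<le> 1 / 2"
      using elim(1) d by (simp add: d_def field_simps)
    ultimately show ?case
      using time_constant_bounds[OF assms(3)[OF lam(2)] assms(4)[OF lam(2)] assms(1,2) pos] pos
      by (simp add: d_def)
  qed
  then show ?thesis
    unfolding \<epsilon>_def d_def by (rule bigoI)
qed

end
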